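(* For every integer $m\ge 1$, the number of spanning trees of the straight linear 2-tree with $m$ triangles (i.e. on $m+2$ vertices) is $F_{2m+2}$.
   Context: The straight linear 2-tree on $n$ vertices is the graph with vertex set $\{1,\dots,n\}$ in which $\{i,j\}$ is an edge if and only if $0<|i-j|\le 2$; it has $m=n-2$ triangles. $F_p$ denotes the $p$-th Fibonacci number ($F_0=0$, $F_1=1$, $F_{p+1}=F_p+F_{p-1}$). *)

theory Defs
  imports "HOL-Number_Theory.Fib"
begin

datatype 'a ugraph = UGraph (verts: "'a set") (edges: "'a set set")

definition simple_graph :: "'a ugraph \<Rightarrow> bool" where
  "simple_graph G \<longleftrightarrow>
     (\<forall>e\<in>edges G. \<exists>u v. u \<in> verts G \<and> v \<in> verts G \<and> u \<noteq> v \<and> e = {u, v})"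

text \<open>A walk is given by its sequence of vertices.\<close>

definition walk :: "'a ugraph \<Rightarrow> 'a list \<Rightarrow> bool" where
  "walk G p \<longleftrightarrow>
     p \<noteq> [] \<and> set p \<subseteq> verts G \<and> successively (\<lambda>u v. {u, v} \<in> edges G) p"

definition connected_graph :: "'a ugraph \<Rightarrow> bool" where
  "connected_graph G \<longleftrightarrow> verts G \<noteq> {} \<and>
     (\<forall>u\<in>verts G. \<forall>v\<in>verts G. \<exists>p. walk G p \<and> hd p = u \<and> last p = v)"

text \<open>The closing edge joins the last vertex of the list to the first, which is not repeated.\<close>

definition graph_cycle :: "'a ugraph \<Rightarrow> 'a list \<Rightarrow> bool" where
  "graph_cycle G p \<longleftrightarrow>
     walk G p \<and> distinct p \<and> length p \<ge> 3 \<and> {last p, hd p} \<in> edges G"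

definition is_tree :: "'a ugraph \<Rightarrow> bool" where
  "is_tree G \<longleftrightarrow> simple_graph G \<and> connected_graph G \<and> (\<nexists>p. graph_cycle G p)"

definition is_subgraph :: "'a ugraph \<Rightarrow> 'a ugraph \<Rightarrow> bool" where
  "is_subgraph H G \<longleftrightarrow> simple_graph H \<and> verts H \<subseteq> verts G \<and> edges H \<subseteq> edges G"

definition spanning_trees :: "'a ugraph \<Rightarrow> 'a ugraph set" where
  "spanning_trees G = {T. is_subgraph T G \<and> verts T = verts G \<and> is_tree T}"

definition straight_linear_2_tree :: "nat \<Rightarrow> nat ugraph" where
  "straight_linear_2_tree n =
     UGraph {1..n}
       {{i, j} | i j. i \<in> {1..n} \<and> j \<in> {1..n} \<and>
          0 < \<bar>int i - int j\<bar> \<and> \<bar>int i - int j\<bar> \<le> 2}"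

lemma simple_graph_straight_linear_2_tree: "simple_graph (straight_linear_2_tree n)"
  unfolding simple_graph_def straight_linear_2_tree_def by fastforce

end

theory Submission
  imports Defs
begin

text \<open>
  Write \<open>t n\<close> for the number of spanning trees of the straight linear 2-tree on \<open>n\<close> vertices, and
  \<open>s n\<close> for the number of those containing the last edge \<open>{n - 1, n}\<close>. The new vertex \<open>n + 1\<close> has
  the two neighbours \<open>n - 1\<close> and \<open>n\<close>. In a spanning tree it is either a leaf hanging from one of
  them, or it subdivides the edge \<open>{n - 1, n}\<close> of a spanning tree on \<open>n\<close> vertices. Hence
  \<open>t (n + 1) = 2 * t n + s n\<close> and \<open>s (n + 1) = t n + s n\<close>, with \<open>t 2 = s 2 = 1\<close>.

  Trees are handled as minimally connected graphs, and connectedness by the absence of cuts, which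
  makes the effect of adding a leaf or subdividing an edge a matter of propositional reasoning.
\<close>

section \<open>Cuts and connectedness\<close>

definition cut_set :: "'a set set \<Rightarrow> 'a set \<Rightarrow> bool" where
  "cut_set E A \<longleftrightarrow> (\<forall>x y. {x, y} \<in> E \<longrightarrow> (x \<in> A \<longleftrightarrow> y \<in> A))"

text \<open>Connectedness without paths: a set crossed by no edge contains all of \<open>V\<close>
  or none of it. \<open>A\<close> need not lie in \<open>V\<close>, so membership of a point on no
  edge can be changed freely.\<close>

definition joined :: "'a set \<Rightarrow> 'a set set \<Rightarrow> bool" where
  "joined V E \<longleftrightarrow> (\<forall>A. cut_set E A \<longrightarrow> (\<forall>x\<in>V. \<forall>y\<in>V. x \<in> A \<longleftrightarrow> y \<in> A))"

lemma cut_setD: "cut_set E A \<Longrightarrow> {x, y} \<in> E \<Longrightarrow> x \<in> A \<longleftrightarrow> y \<in> A"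
  unfolding cut_set_def by blast

lemma joinedD: "joined V E \<Longrightarrow> cut_set E A \<Longrightarrow> x \<in> V \<Longrightarrow> y \<in> V \<Longrightarrow> x \<in> A \<longleftrightarrow> y \<in> A"
  unfolding joined_def by blast

text \<open>Cuts reverse the direction: if \<open>F\<close> has no cuts beyond those of
  \<open>E\<close>, connectedness passes from \<open>E\<close> to \<open>F\<close>. This serves to
  discard an edge whose constraint the remaining edges already enforce.\<close>

lemma joined_weaken: "(\<And>A. cut_set F A \<Longrightarrow> cut_set E A) \<Longrightarrow> joined V E \<Longrightarrow> joined V F"
  unfolding joined_def by blast

text \<open>An edge contributes exactly one equivalence, which turns edge surgery into propositional
  logic.\<close>

lemma cut_insert: "cut_set (insert {u, w} E) A \<longleftrightarrow> cut_set E A \<and> (u \<in> A \<longleftrightarrow> w \<in> A)"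
  unfolding cut_set_def insert_iff doubleton_eq_iff by blast

lemma cut_cong: "(\<And>x. x \<in> \<Union>E \<Longrightarrow> x \<in> A \<longleftrightarrow> x \<in> B) \<Longrightarrow> cut_set E A \<longleftrightarrow> cut_set E B"
  unfolding cut_set_def by (smt (verit) UnionI insertCI)

subsection \<open>Trees as minimally connected graphs\<close>

lemma walk_cut:
  assumes "cut_set E A" "walk (UGraph V E) p"
  shows "hd p \<in> A \<longleftrightarrow> last p \<in> A"
proof -
  have "p \<noteq> [] \<Longrightarrow> successively (\<lambda>u v. {u, v} \<in> E) p \<Longrightarrow> hd p \<in> A \<longleftrightarrow> last p \<in> A"
  proof (induction p)
    case (Cons a p)
    show ?case
    proof (cases p)
      case (Cons b q)
      then show ?thesis using "Cons.prems" "Cons.IH" cut_setD[OF assms(1), of a b] by simp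
    qed simp
  qed simp
  then show ?thesis using assms(2) by (simp add: walk_def)
qed

text \<open>The set of vertices reachable from \<open>u\<close> by a path is crossed by no edge, so
  it contains \<open>v\<close> along with \<open>u\<close>. Distinctness is kept because such a path
  will be closed to a cycle.\<close>

lemma joined_imp_path:
  assumes "joined V E" "\<Union>E \<subseteq> V" "u \<in> V" "v \<in> V"
  shows "\<exists>p. walk (UGraph V E) p \<and> distinct p \<and> hd p = u \<and> last p = v"
proof -
  define A where "A = {y. \<exists>p. walk (UGraph V E) p \<and> distinct p \<and> hd p = u \<and> last p = y}"
  have step: "y \<in> A" if "x \<in> A" "{x, y} \<in> E" for x y
  proof -
    obtain p where p: "walk (UGraph V E) p" "distinct p" "hd p = u" "last p = x"
      using \<open>x \<in> A\<close> by (auto simp: A_def)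
    show ?thesis
    \<comment> \<open>A path already passing through \<open>y\<close> is truncated there; otherwise
      it is extended by \<open>y\<close>.\<close>
    proof (cases "y \<in> set p")
      case True
      then obtain q r where "p = (q @ [y]) @ r" by (metis append.assoc append_Cons append_Nil split_list)
      then have "walk (UGraph V E) (q @ [y])" "distinct (q @ [y])" "hd (q @ [y]) = u"
        using p by (auto simp: walk_def successively_append_iff hd_append)
      then show ?thesis unfolding A_def by fastforce
    next
      case False
      have "y \<in> V" using that(2) assms(2) by auto
      then have "walk (UGraph V E) (p @ [y])" "distinct (p @ [y])" "hd (p @ [y]) = u"
        using p that(2) False by (auto simp: walk_def successively_append_iff)
      then show ?thesis unfolding A_def by fastforce
    qed
  qed
  have "cut_set E A"
    unfolding cut_set_def using step by (metis insert_commute)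
  moreover have "u \<in> A"
    using assms(3) by (auto simp: A_def walk_def intro!: exI[of _ "[u]"])
  ultimately have "v \<in> A" using joinedD[OF assms(1)] assms(3,4) by blast
  then show ?thesis by (simp add: A_def)
qed

lemma connected_graph_iff_joined:
  assumes "\<Union>E \<subseteq> V"
  shows "connected_graph (UGraph V E) \<longleftrightarrow> V \<noteq> {} \<and> joined V E"
proof
  assume "connected_graph (UGraph V E)"
  then have "V \<noteq> {}" and path: "\<forall>x\<in>V. \<forall>y\<in>V. \<exists>p. walk (UGraph V E) p \<and> hd p = x \<and> last p = y"
    unfolding connected_graph_def ugraph.sel by (rule conjunct1, rule conjunct2)
  moreover have "joined V E"
    unfolding joined_def
  proof (intro allI impI ballI)
    fix A x y assume "cut_set E A" "x \<in> V" "y \<in> V"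
    moreover from this path obtain p where "walk (UGraph V E) p" "hd p = x" "last p = y" by meson
    ultimately show "x \<in> A \<longleftrightarrow> y \<in> A" using walk_cut[of E A V p] by simp
  qed
  ultimately show "V \<noteq> {} \<and> joined V E" by (intro conjI)
next
  assume "V \<noteq> {} \<and> joined V E"
  then show "connected_graph (UGraph V E)"
    unfolding connected_graph_def ugraph.sel using joined_imp_path[OF _ assms] by blast
qed

text \<open>The rest of the cycle is a walk between the ends of the closing edge, so every cut of
  the remaining edges keeps these ends on one side.\<close>

lemma closing_edge_removable:
  assumes "graph_cycle (UGraph V E) p" "joined V E"
  shows "joined V (E - {{last p, hd p}})"
proof -
  let ?E = "E - {{last p, hd p}}"
  have p: "p \<noteq> []" "distinct p" "length p \<ge> 3" "walk (UGraph V E) p"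
    using assms(1) by (auto simp: graph_cycle_def walk_def)
  \<comment> \<open>The walk never uses the closing edge, by distinctness. At \<open>i = 0\<close>
    the length bound matters: with two vertices the first step would be the closing edge.\<close>
  have "{p ! i, p ! Suc i} \<noteq> {last p, hd p}" if "Suc i < length p" for i
  proof -
    have "p ! i \<noteq> last p"
      using p that by (auto simp: last_conv_nth nth_eq_iff_index_eq)
    moreover have "i = 0 \<Longrightarrow> p ! Suc i \<noteq> last p"
      using p that by (auto simp: last_conv_nth nth_eq_iff_index_eq)
    moreover have "i \<noteq> 0 \<Longrightarrow> p ! i \<noteq> hd p"
      using p that by (auto simp: hd_conv_nth nth_eq_iff_index_eq)
    ultimately show ?thesis by (auto simp: doubleton_eq_iff)
  qed
  then have w: "walk (UGraph V ?E) p"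
    using p(4) by (auto simp: walk_def successively_conv_nth)
  have E: "insert {last p, hd p} ?E = E"
    using assms(1) by (auto simp: graph_cycle_def)
  have "cut_set E A" if A: "cut_set ?E A" for A
    using A walk_cut[OF A w] cut_insert[of "last p" "hd p" ?E A] unfolding E by simp
  then show ?thesis using assms(2) by (rule joined_weaken)
qed

text \<open>If the graph stays connected without \<open>e\<close>, a path avoiding \<open>e\<close>
  joins its ends, and \<open>e\<close> closes it to a cycle.\<close>

lemma removable_edge_closes_cycle:
  assumes "joined V (E - {e})" "simple_graph (UGraph V E)" "e \<in> E"
  shows "\<exists>p. graph_cycle (UGraph V E) p"
proof -
  obtain u v where e: "e = {u, v}" "u \<noteq> v" "u \<in> V" "v \<in> V"
    using assms(2,3) by (auto simp: simple_graph_def)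
  have "\<Union>(E - {e}) \<subseteq> V" using assms(2) by (fastforce simp: simple_graph_def)
  then obtain p where p: "walk (UGraph V (E - {e})) p" "distinct p" "hd p = u" "last p = v"
    using joined_imp_path[OF assms(1)] e by blast
  \<comment> \<open>A path on one vertex would force \<open>u = v\<close>, and one on two vertices
    would use the deleted edge \<open>e\<close>.\<close>
  have "length p \<ge> 3"
  proof (rule ccontr)
    assume "\<not> length p \<ge> 3"
    then consider "p = []" | a where "p = [a]" | a b where "p = [a, b]"
      by (cases p rule: remdups_adj.cases) (auto simp: not_le numeral_3_eq_3 less_Suc_eq)
    then show False using p e by cases (auto simp: walk_def)
  qed
  moreover have "walk (UGraph V E) p"
    using p(1) by (auto simp: walk_def successively_conv_nth)
  ultimately have "graph_cycle (UGraph V E) p"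
    using p e assms(3) by (auto simp: graph_cycle_def insert_commute)
  then show ?thesis ..
qed

text \<open>In a connected graph an edge is removable precisely when some cycle exists to be broken,
  by the two preceding lemmas.\<close>

lemma is_tree_iff_minimally_joined:
  "is_tree (UGraph V E) \<longleftrightarrow>
     simple_graph (UGraph V E) \<and> V \<noteq> {} \<and> joined V E \<and> (\<forall>e\<in>E. \<not> joined V (E - {e}))"
proof (cases "simple_graph (UGraph V E)")
  case True
  then have "\<Union>E \<subseteq> V" by (fastforce simp: simple_graph_def)
  note conn = connected_graph_iff_joined[OF this]
  have "(\<exists>p. graph_cycle (UGraph V E) p) \<longleftrightarrow> (\<exists>e\<in>E. joined V (E - {e}))" if "joined V E"
  proof
    assume "\<exists>p. graph_cycle (UGraph V E) p"
    then obtain p where p: "graph_cycle (UGraph V E) p" ..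
    then have "{last p, hd p} \<in> E" by (simp add: graph_cycle_def)
    then show "\<exists>e\<in>E. joined V (E - {e})"
      using closing_edge_removable[OF p that] by (rule bexI[rotated])
  next
    assume "\<exists>e\<in>E. joined V (E - {e})"
    then obtain e where "e \<in> E" "joined V (E - {e})" ..
    then show "\<exists>p. graph_cycle (UGraph V E) p"
      by (intro removable_edge_closes_cycle[OF _ True])
  qed
  then show ?thesis unfolding is_tree_def conn by (cases "joined V E") (simp_all add: True)
qed (simp add: is_tree_def)

subsection \<open>Adding a vertex of degree at most two\<close>

lemma cut_insert_vertex_irrelevant:
  assumes "v \<notin> \<Union>E"
  shows "cut_set E (insert v A) \<longleftrightarrow> cut_set E A" "cut_set E (A - {v}) \<longleftrightarrow> cut_set E A"
  using assms by (auto intro!: cut_cong)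

lemma not_joined_isolated:
  assumes "v \<notin> \<Union>E" "V \<noteq> {}" "v \<notin> V"
  shows "\<not> joined (insert v V) E"
proof -
  have "cut_set E {v}" using assms(1) by (auto simp: cut_set_def)
  then show ?thesis using assms(2,3) joinedD[of "insert v V" E "{v}" v] by auto
qed

lemma joined_leaf:
  assumes "v \<notin> V" "\<Union>E \<subseteq> V" "u \<in> V"
  shows "joined (insert v V) (insert {v, u} E) \<longleftrightarrow> joined V E"
proof
  assume L: "joined (insert v V) (insert {v, u} E)"
  have v: "v \<notin> \<Union>E" using assms by auto
  show "joined V E"
    unfolding joined_def
  proof (intro allI impI ballI)
    fix A x y assume A: "cut_set E A" "x \<in> V" "y \<in> V"
    \<comment> \<open>Placing \<open>v\<close> on the side of \<open>u\<close> satisfies the new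
      edge and changes nothing on \<open>V\<close>.\<close>
    define B where "B = (if u \<in> A then insert v A else A - {v})"
    have "cut_set (insert {v, u} E) B"
      using A(1) assms v by (auto simp: cut_insert B_def cut_insert_vertex_irrelevant)
    from joinedD[OF L this, of x y] show "x \<in> A \<longleftrightarrow> y \<in> A"
      using A assms(1) by (auto simp: B_def split: if_splits)
  qed
next
  assume R: "joined V E"
  show "joined (insert v V) (insert {v, u} E)"
    unfolding joined_def cut_insert using joinedD[OF R] assms(3) by blast
qed

text \<open>Once \<open>v\<close> is on the side of \<open>u\<close>, the constraints of
  \<open>{v, w}\<close> and \<open>{u, w}\<close> coincide; after trading one for the other,
  \<open>v\<close> is a leaf.\<close>

lemma joined_subdivide:
  assumes "v \<notin> V" "\<Union>E \<subseteq> V" "u \<in> V" "w \<in> V"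
  shows "joined (insert v V) (insert {v, u} (insert {v, w} E)) \<longleftrightarrow> joined V (insert {u, w} E)"
proof -
  have "joined (insert v V) (insert {v, u} (insert {v, w} E)) \<longleftrightarrow>
        joined (insert v V) (insert {v, u} (insert {u, w} E))"
    unfolding joined_def cut_insert by blast
  also have "\<dots> \<longleftrightarrow> joined V (insert {u, w} E)"
    using assms by (intro joined_leaf) auto
  finally show ?thesis .
qed

lemma simple_graph_insert_edge:
  "simple_graph (UGraph V (insert {u, w} E)) \<longleftrightarrow>
     simple_graph (UGraph V E) \<and> u \<in> V \<and> w \<in> V \<and> u \<noteq> w"
  unfolding simple_graph_def ugraph.sel by (auto simp: doubleton_eq_iff)

lemma simple_graph_insert_vertex:
  assumes "v \<notin> \<Union>E"
  shows "simple_graph (UGraph (insert v V) E) \<longleftrightarrow> simple_graph (UGraph V E)"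
  using assms unfolding simple_graph_def ugraph.sel by fastforce

text \<open>Minimality is compared edge by edge: deleting an old edge commutes with removing the
  leaf, and deleting the new edge isolates \<open>v\<close>.\<close>

lemma is_tree_leaf:
  assumes "v \<notin> V" "\<Union>E \<subseteq> V" "u \<in> V"
  shows "is_tree (UGraph (insert v V) (insert {v, u} E)) \<longleftrightarrow> is_tree (UGraph V E)"
proof -
  have v: "v \<notin> \<Union>E" and nE: "{v, u} \<notin> E" using assms by auto
  have "joined (insert v V) (insert {v, u} E - {e}) \<longleftrightarrow> joined V (E - {e})" if "e \<in> E" for e
  proof -
    have "insert {v, u} E - {e} = insert {v, u} (E - {e})" using that nE by auto
    moreover have "\<Union>(E - {e}) \<subseteq> V" using assms(2) by blast
    ultimately show ?thesis by (simp only: joined_leaf[OF assms(1) _ assms(3)])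
  qed
  moreover have "insert {v, u} E - {{v, u}} = E" "V \<noteq> {}" using nE assms(3) by auto
  ultimately have "(\<forall>e\<in>insert {v, u} E. \<not> joined (insert v V) (insert {v, u} E - {e})) \<longleftrightarrow>
      (\<forall>e\<in>E. \<not> joined V (E - {e}))"
    using not_joined_isolated[OF v _ assms(1)] by simp
  moreover have "simple_graph (UGraph (insert v V) (insert {v, u} E)) \<longleftrightarrow> simple_graph (UGraph V E)"
    unfolding simple_graph_insert_edge simple_graph_insert_vertex[OF v] using assms(1,3) by auto
  ultimately show ?thesis
    unfolding is_tree_iff_minimally_joined using joined_leaf[OF assms] \<open>V \<noteq> {}\<close> by simp
qed

text \<open>Deleting either half of the subdivided edge leaves \<open>v\<close> as a leaf over
  \<open>E\<close>, which matches deleting \<open>{u, w}\<close> itself; other edges correspond to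
  themselves.\<close>

lemma is_tree_subdivide:
  assumes "v \<notin> V" "\<Union>E \<subseteq> V" "u \<in> V" "w \<in> V" "u \<noteq> w" "{u, w} \<notin> E"
  shows "is_tree (UGraph (insert v V) (insert {v, u} (insert {v, w} E))) \<longleftrightarrow>
         is_tree (UGraph V (insert {u, w} E))"
proof -
  let ?E = "insert {v, u} (insert {v, w} E)"
  have v: "v \<notin> \<Union>E" and nE: "{v, u} \<notin> E" "{v, w} \<notin> E" using assms by auto
  have ne: "{v, u} \<noteq> {v, w}" using assms by (auto simp: doubleton_eq_iff)
  have "joined (insert v V) (?E - {e}) \<longleftrightarrow> joined V (insert {u, w} E - {e})" if "e \<in> E" for e
  proof -
    have "?E - {e} = insert {v, u} (insert {v, w} (E - {e}))"
         "insert {u, w} E - {e} = insert {u, w} (E - {e})" using that nE assms(6) by auto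
    moreover have "\<Union>(E - {e}) \<subseteq> V" using assms(2) by blast
    ultimately show ?thesis by (simp only: joined_subdivide[OF assms(1) _ assms(3,4)])
  qed
  moreover have "?E - {{v, u}} = insert {v, w} E" "?E - {{v, w}} = insert {v, u} E"
    "insert {u, w} E - {{u, w}} = E"
    using ne nE assms(6) by auto
  ultimately have "(\<forall>e\<in>?E. \<not> joined (insert v V) (?E - {e})) \<longleftrightarrow>
      (\<forall>e\<in>insert {u, w} E. \<not> joined V (insert {u, w} E - {e}))"
    using joined_leaf[OF assms(1,2)] assms(3,4) by simp
  moreover have "simple_graph (UGraph (insert v V) ?E) \<longleftrightarrow> simple_graph (UGraph V (insert {u, w} E))"
    unfolding simple_graph_insert_edge simple_graph_insert_vertex[OF v] using assms(1,3-5) by auto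
  moreover have "V \<noteq> {}" using assms(3) by auto
  ultimately show ?thesis
    unfolding is_tree_iff_minimally_joined using joined_subdivide[OF assms(1-4)] by simp
qed

text \<open>The detour through \<open>v\<close> makes \<open>{u, w}\<close> redundant, contradicting
  minimality.\<close>

lemma not_is_tree_triangle:
  assumes "{v, u} \<in> E" "{v, w} \<in> E" "{u, w} \<in> E" "v \<noteq> u" "v \<noteq> w" "u \<noteq> w"
  shows "\<not> is_tree (UGraph V E)"
proof
  assume T: "is_tree (UGraph V E)"
  have E: "insert {u, w} (E - {{u, w}}) = E" using assms(3) by auto
  have vs: "{v, u} \<in> E - {{u, w}}" "{v, w} \<in> E - {{u, w}}"
    using assms by (auto simp: doubleton_eq_iff)
  have "cut_set E A" if A: "cut_set (E - {{u, w}}) A" for A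
  proof -
    have "u \<in> A \<longleftrightarrow> w \<in> A" using A vs unfolding cut_set_def by metis
    then show ?thesis using A cut_insert[of u w "E - {{u, w}}" A] unfolding E by simp
  qed
  moreover have "joined V E" using T unfolding is_tree_iff_minimally_joined by blast
  ultimately have "joined V (E - {{u, w}})" by (rule joined_weaken)
  then show False using T assms(3) unfolding is_tree_iff_minimally_joined by blast
qed

subsection \<open>Spanning trees of the straight linear 2-tree\<close>

abbreviation strip_edges :: "nat \<Rightarrow> nat set set" where
  "strip_edges n \<equiv> edges (straight_linear_2_tree n)"

text \<open>The vertex set of a spanning tree is fixed, so its edge set determines it, and growing a
  tree becomes insertion of edges.\<close>

definition tree_edge_sets :: "nat \<Rightarrow> nat set set set" where
  "tree_edge_sets n = {E. E \<subseteq> strip_edges n \<and> is_tree (UGraph {1..n} E)}"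

lemma card_spanning_trees_strip:
  "card (spanning_trees (straight_linear_2_tree n)) = card (tree_edge_sets n)"
proof -
  have "spanning_trees (straight_linear_2_tree n) = UGraph {1..n} ` tree_edge_sets n"
  proof (intro equalityI subsetI)
    fix T assume "T \<in> spanning_trees (straight_linear_2_tree n)"
    then show "T \<in> UGraph {1..n} ` tree_edge_sets n"
      by (cases T) (auto simp: spanning_trees_def is_subgraph_def tree_edge_sets_def
          straight_linear_2_tree_def)
  next
    fix T assume "T \<in> UGraph {1..n} ` tree_edge_sets n"
    then show "T \<in> spanning_trees (straight_linear_2_tree n)"
      by (auto simp: spanning_trees_def is_subgraph_def tree_edge_sets_def is_tree_def
          straight_linear_2_tree_def)
  qed
  then show ?thesis by (simp add: card_image inj_on_def)
qed

lemma Union_strip_edges: "\<Union>(strip_edges n) \<subseteq> {1..n}"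
  by (auto simp: straight_linear_2_tree_def)

lemma finite_tree_edge_sets: "finite (tree_edge_sets n)"
proof -
  have "finite (strip_edges n)"
    by (rule finite_subset[of _ "Pow {1..n}"]) (use Union_strip_edges in auto)
  then show ?thesis by (simp add: tree_edge_sets_def)
qed

section \<open>The recurrence for adding one vertex\<close>

lemma strip_edges_Suc:
  assumes "n \<ge> 2"
  shows "strip_edges (Suc n) = insert {Suc n, n - 1} (insert {Suc n, n} (strip_edges n))"
proof (intro equalityI subsetI)
  fix e assume "e \<in> strip_edges (Suc n)"
  then obtain i j where "e = {i, j}" "i \<in> {1..Suc n}" "j \<in> {1..Suc n}"
      "0 < \<bar>int i - int j\<bar>" "\<bar>int i - int j\<bar> \<le> 2"
    by (auto simp: straight_linear_2_tree_def)
  then obtain i j where ij: "e = {i, j}" "1 \<le> i" "i < j" "j \<le> Suc n" "j \<le> i + 2"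
    by (cases "i < j") (force simp: insert_commute)+
  show "e \<in> insert {Suc n, n - 1} (insert {Suc n, n} (strip_edges n))"
  proof (cases "j = Suc n")
    case True
    then have "i = n \<or> i = n - 1" using ij by auto
    then show ?thesis using ij True by (auto simp: insert_commute)
  next
    case False
    then have "e \<in> strip_edges n"
      using ij unfolding straight_linear_2_tree_def ugraph.sel
      by (intro CollectI exI[of _ i] exI[of _ j]) auto
    then show ?thesis by simp
  qed
next
  fix e assume "e \<in> insert {Suc n, n - 1} (insert {Suc n, n} (strip_edges n))"
  then consider "e = {Suc n, n - 1}" | "e = {Suc n, n}" | "e \<in> strip_edges n" by blast
  then show "e \<in> strip_edges (Suc n)"
  proof cases
    case 1
    then show ?thesis using assms unfolding straight_linear_2_tree_def ugraph.sel
      by (intro CollectI exI[of _ "Suc n"] exI[of _ "n - 1"]) auto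
  next
    case 2
    then show ?thesis using assms unfolding straight_linear_2_tree_def ugraph.sel
      by (intro CollectI exI[of _ "Suc n"] exI[of _ n]) auto
  next
    case 3
    then show ?thesis by (fastforce simp: straight_linear_2_tree_def)
  qed
qed

lemma last_edge_strip: "n \<ge> 2 \<Longrightarrow> {n - 1, n} \<in> strip_edges n"
  unfolding straight_linear_2_tree_def ugraph.sel
  by (intro CollectI exI[of _ "n - 1"] exI[of _ n]) auto

text \<open>The cases are the possible sets of new edges at \<open>Suc n\<close>: none isolates it,
  one makes it a leaf, and both make it subdivide \<open>c\<close>. In the last case
  \<open>c\<close> cannot be present as well, since it would complete a triangle.\<close>

lemma tree_edge_sets_Suc_iff:
  assumes "n \<ge> 2" "E \<subseteq> strip_edges n"
  defines "a \<equiv> {Suc n, n - 1}" and "b \<equiv> {Suc n, n}" and "c \<equiv> {n - 1, n}"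
  shows "E \<notin> tree_edge_sets (Suc n)"
    and "insert a E \<in> tree_edge_sets (Suc n) \<longleftrightarrow> E \<in> tree_edge_sets n"
    and "insert b E \<in> tree_edge_sets (Suc n) \<longleftrightarrow> E \<in> tree_edge_sets n"
    and "insert a (insert b E) \<in> tree_edge_sets (Suc n) \<longleftrightarrow> c \<notin> E \<and> insert c E \<in> tree_edge_sets n"
proof -
  have V: "{1..Suc n} = insert (Suc n) {1..n}" by auto
  have E: "\<Union>E \<subseteq> {1..n}" using assms(2) Union_strip_edges by blast
  have vs: "Suc n \<notin> {1..n}" "n - 1 \<in> {1..n}" "n \<in> {1..n}" "n - 1 \<noteq> n" using assms(1) by auto
  have sub: "insert a (insert b E) \<subseteq> strip_edges (Suc n)" "insert c E \<subseteq> strip_edges n"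
    using strip_edges_Suc[OF assms(1)] last_edge_strip[OF assms(1)] assms(2)
    by (auto simp: a_def b_def c_def)
  show "E \<notin> tree_edge_sets (Suc n)"
    using not_joined_isolated[of "Suc n" E "{1..n}"] E vs
    unfolding tree_edge_sets_def is_tree_iff_minimally_joined V by blast
  show "insert a E \<in> tree_edge_sets (Suc n) \<longleftrightarrow> E \<in> tree_edge_sets n"
    using is_tree_leaf[OF vs(1) E vs(2)] sub assms(2) unfolding tree_edge_sets_def V a_def by simp
  show "insert b E \<in> tree_edge_sets (Suc n) \<longleftrightarrow> E \<in> tree_edge_sets n"
    using is_tree_leaf[OF vs(1) E vs(3)] sub assms(2) unfolding tree_edge_sets_def V b_def by simp
  show "insert a (insert b E) \<in> tree_edge_sets (Suc n) \<longleftrightarrow> c \<notin> E \<and> insert c E \<in> tree_edge_sets n"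
  proof (cases "c \<in> E")
    case True
    then have "\<not> is_tree (UGraph {1..Suc n} (insert a (insert b E)))"
      using vs unfolding a_def b_def c_def
      by (intro not_is_tree_triangle[of "Suc n" "n - 1" _ n]) auto
    then show ?thesis using True by (simp add: tree_edge_sets_def)
  next
    case False
    then show ?thesis
      using is_tree_subdivide[OF vs(1) E vs(2,3,4)] sub
      unfolding tree_edge_sets_def V a_def b_def c_def by simp
  qed
qed

abbreviation last_edge_trees :: "nat \<Rightarrow> nat set set set" where
  "last_edge_trees n \<equiv> {E \<in> tree_edge_sets n. {n - 1, n} \<in> E}"

lemma tree_edge_sets_Suc:
  assumes "n \<ge> 2"
  defines "a \<equiv> {Suc n, n - 1}" and "b \<equiv> {Suc n, n}" and "c \<equiv> {n - 1, n}"
  shows "tree_edge_sets (Suc n) = insert a ` tree_edge_sets n \<union> (insert b ` tree_edge_sets n \<union>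
           (\<lambda>E. insert a (insert b (E - {c}))) ` last_edge_trees n)" (is "_ = ?R")
proof (intro equalityI subsetI)
  note iff = tree_edge_sets_Suc_iff[OF assms(1), folded a_def b_def c_def]
  fix F assume F: "F \<in> tree_edge_sets (Suc n)"
  define E where "E = F - {a, b}"
  have E: "E \<subseteq> strip_edges n"
    using F strip_edges_Suc[OF assms(1)] by (auto simp: E_def tree_edge_sets_def a_def b_def)
  consider "F = E" | "F = insert a E" | "F = insert b E" | "F = insert a (insert b E)"
    unfolding E_def by blast
  then show "F \<in> ?R"
  proof cases
    case 4
    then have "c \<notin> E" "insert c E \<in> tree_edge_sets n" using F iff(4)[OF E] by auto
    \<comment> \<open>Undoing the subdivision: the preimage of \<open>F\<close> is
      \<open>insert c E\<close>.\<close>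
    moreover from this have "F = insert a (insert b (insert c E - {c}))" using 4 by auto
    ultimately have "F \<in> (\<lambda>E. insert a (insert b (E - {c}))) ` last_edge_trees n"
      by (intro rev_image_eqI[of "insert c E"]) (auto simp: c_def)
    then show ?thesis by blast
  qed (use F iff(1-3)[OF E] in auto)
next
  note iff = tree_edge_sets_Suc_iff[OF assms(1), folded a_def b_def c_def]
  have sub: "E \<subseteq> strip_edges n" if "E \<in> tree_edge_sets n" for E
    using that by (simp add: tree_edge_sets_def)
  fix F assume "F \<in> ?R"
  then show "F \<in> tree_edge_sets (Suc n)"
  proof (elim UnE imageE)
    fix E assume "F = insert a (insert b (E - {c}))" "E \<in> last_edge_trees n"
    then show ?thesis
      using iff(4)[of "E - {c}"] sub[of E] by (auto simp: c_def insert_absorb)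
  qed (use iff(2,3) sub in auto)
qed

text \<open>Membership of \<open>a\<close> and \<open>b\<close> tells the three families apart. The
  second and third are those containing \<open>b\<close>, the last edge of the longer strip, which
  yields the second equation.\<close>

lemma card_tree_edge_sets_Suc:
  assumes "n \<ge> 2"
  shows "card (tree_edge_sets (Suc n)) = 2 * card (tree_edge_sets n) + card (last_edge_trees n)"
    and "card (last_edge_trees (Suc n)) = card (tree_edge_sets n) + card (last_edge_trees n)"
proof -
  define a b c where abc: "a = {Suc n, n - 1}" "b = {Suc n, n}" "c = {n - 1, n}"
  define A B C where ABC: "A = insert a ` tree_edge_sets n" "B = insert b ` tree_edge_sets n"
    "C = (\<lambda>E. insert a (insert b (E - {c}))) ` last_edge_trees n"
  have ab: "a \<noteq> b" using assms by (auto simp: abc doubleton_eq_iff)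
  have notin: "a \<notin> E" "b \<notin> E" if "E \<in> tree_edge_sets n" for E
  proof -
    have "\<Union>E \<subseteq> {1..n}" using that Union_strip_edges[of n] by (auto simp: tree_edge_sets_def)
    then have "Suc n \<notin> \<Union>E" by auto
    then show "a \<notin> E" "b \<notin> E" by (auto simp: abc)
  qed
  have "inj_on (insert a) (tree_edge_sets n)" "inj_on (insert b) (tree_edge_sets n)"
    using notin by (auto intro!: inj_onI simp: insert_ident)
  moreover have "inj_on (\<lambda>E. insert a (insert b (E - {c}))) (last_edge_trees n)"
  proof (rule inj_onI)
    fix E F assume EF: "E \<in> last_edge_trees n" "F \<in> last_edge_trees n"
      and eq: "insert a (insert b (E - {c})) = insert a (insert b (F - {c}))"
    \<comment> \<open>An explicit left inverse of the subdivision map: drop \<open>a\<close> and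
      \<open>b\<close>, then restore \<open>c\<close>.\<close>
    have "G = insert c (insert a (insert b (G - {c})) - {a, b})" if "G \<in> last_edge_trees n" for G
      using that notin[of G] by (auto simp: abc(3))
    then show "E = F" using EF eq by metis
  qed
  ultimately have card: "card A = card (tree_edge_sets n)" "card B = card (tree_edge_sets n)"
    "card C = card (last_edge_trees n)"
    by (simp_all add: ABC card_image)
  have fin: "finite A" "finite B" "finite C" by (simp_all add: ABC finite_tree_edge_sets)
  have mem: "b \<notin> E" if "E \<in> A" for E using that notin ab by (auto simp: ABC)
  have mem': "b \<in> E" if "E \<in> B \<union> C" for E using that by (auto simp: ABC)
  have disj: "A \<inter> (B \<union> C) = {}" using mem mem' by blast
  have "a \<notin> E" if "E \<in> B" for E using that notin ab by (auto simp: ABC)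
  moreover have "a \<in> E" if "E \<in> C" for E using that by (auto simp: ABC)
  ultimately have disj': "B \<inter> C = {}" by blast
  have T: "tree_edge_sets (Suc n) = A \<union> (B \<union> C)"
    using tree_edge_sets_Suc[OF assms] by (simp add: ABC abc)
  then have L: "last_edge_trees (Suc n) = B \<union> C"
    using mem mem' by (auto simp: abc(2) insert_commute)
  show "card (tree_edge_sets (Suc n)) = 2 * card (tree_edge_sets n) + card (last_edge_trees n)"
    unfolding T using card_Un_disjoint[OF fin(1) _ disj] card_Un_disjoint[OF fin(2,3) disj'] fin card
    by simp
  show "card (last_edge_trees (Suc n)) = card (tree_edge_sets n) + card (last_edge_trees n)"
    unfolding L using card_Un_disjoint[OF fin(2,3) disj'] card by simp
qed

section \<open>Base case and Fibonacci numbers\<close>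

lemma tree_edge_sets_2: "tree_edge_sets 2 = {{{1, 2}}}"
proof -
  have S: "strip_edges 2 = {{1, 2}}"
  proof (intro equalityI subsetI)
    fix e assume "e \<in> strip_edges 2"
    then obtain i j where ij: "e = {i, j}" "i \<in> {1..2}" "j \<in> {1..2}" "i \<noteq> j"
      by (auto simp: straight_linear_2_tree_def)
    then have "i = 1 \<and> j = 2 \<or> i = 2 \<and> j = 1" by auto
    then show "e \<in> {{1, 2}}" using ij by auto
  qed (use last_edge_strip[of 2] in simp)
  have V: "{1..2} = insert 2 {1::nat}" by auto
  \<comment> \<open>The one-edge tree arises by hanging the leaf \<open>2\<close> on the single
    vertex \<open>1\<close>.\<close>
  have "is_tree (UGraph {1} ({} :: nat set set))"
    by (simp add: is_tree_iff_minimally_joined simple_graph_def joined_def)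
  then have "is_tree (UGraph {1..2} {{1, 2::nat}})"
    using is_tree_leaf[of "2::nat" "{1}" "{}" 1] unfolding V by (simp add: insert_commute)
  moreover have "\<not> is_tree (UGraph {1..2} ({} :: nat set set))"
    using not_joined_isolated[of "2::nat" "{}" "{1}"]
    unfolding V is_tree_iff_minimally_joined by simp
  ultimately show ?thesis unfolding tree_edge_sets_def S subset_singleton_iff by auto
qed

text \<open>Both counts must be carried through the induction. With \<open>p = 2 * m + 2\<close>,
  the recurrences read \<open>2 * fib p + fib (p - 1) = fib (p + 2)\<close> and
  \<open>fib p + fib (p - 1) = fib (p + 1)\<close>.\<close>

lemma card_tree_edge_sets:
  "card (tree_edge_sets (m + 2)) = fib (2 * m + 2) \<and> card (last_edge_trees (m + 2)) = fib (2 * m + 1)"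
proof (induction m)
  case 0
  have L: "last_edge_trees 2 = {{{1, 2}}}" by (auto simp: tree_edge_sets_2)
  show ?case unfolding add_0 L unfolding tree_edge_sets_2 by simp
next
  case (Suc m)
  then show ?case using card_tree_edge_sets_Suc[of "m + 2"] by simp
qed

theorem theorem5p1:
  fixes m :: nat
  assumes "m \<ge> 1"
  shows "card (spanning_trees (straight_linear_2_tree (m + 2))) = fib (2 * m + 2)"
  using card_tree_edge_sets card_spanning_trees_strip by simp

end
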